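(* Let $A$ and $B$ be small categories. If $A$ or $B$ is a discrete category, then the imported product $A\times B$ in $\mathcal{L}\mathrm{ens}$ coincides with the cartesian product in $\mathcal{L}\mathrm{ens}$; that is, the imported product projection lenses $A\times B\rightleftharpoons A$ and $A\times B\rightleftharpoons B$ form a product cone in the category $\mathcal{L}\mathrm{ens}$.
   Context: All categories that are objects of $\mathcal{L}\mathrm{ens}$ are small. A (delta) lens $(f,\varphi)\colon A \rightleftharpoons B$ between small categories consists of a functor $f\colon A\to B$ together with a lifting operation assigning to each pair ($a\in A$, $u\colon fa\to b$ in $B$) a morphism $\varphi(a,u)\colon a\to a'$ of $A$ with domain $a$, such that (1) $f\varphi(a,u)=u$; (2) $\varphi(a,1_{fa})=1_a$; (3) $\varphi(a,v\circ u)=\varphi(a',v)\circ\varphi(a,u)$, where $a'$ is the codomain of $\varphi(a,u)$. $\mathcal{L}\mathrm{ens}$ is the category with small categories as objects and lenses as morphisms; the composite of $(f,\varphi)\colon A\rightleftharpoons B$ and $(g,\gamma)\colon B\rightleftharpoons C$ is the functor $g\circ f$ with lifting operation $(a,u\colon gfa\to c)\mapsto \varphi(a,\gamma(fa,u))$, and the identity lens on $A$ is the identity functor with lifting operation $(a,u)\mapsto u$. The imported product of small categories $A$ and $B$ is the product category $A\times B$ together with the projection lenses whose underlying functors are the product projections $\pi_0\colon A\times B\to A$ and $\pi_1\colon A\times B\to B$, with lifting operations $((a,b),u\colon a\to a')\mapsto (u,1_b)$ and $((a,b),v\colon b\to b')\mapsto (1_a,v)$ respectively. A category is discrete if its only morphisms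 are identities. *)

theory Defs
  imports "HOL-Library.FuncSet"
begin

section \<open>Small categories\<close>

text \<open>\<open>Comp C v u\<close> is the composite "v after u"; it is only constrained when \<open>u\<close> and \<open>v\<close> are arrows
  with \<open>Cod C u = Dom C v\<close>. As the objects and the arrows form sets, all these categories are small.\<close>

record ('o, 'm) cat_data =
  Obj :: "'o set"
  Arr :: "'m set"
  Dom :: "'m \<Rightarrow> 'o"
  Cod :: "'m \<Rightarrow> 'o"
  Id :: "'o \<Rightarrow> 'm"
  Comp :: "'m \<Rightarrow> 'm \<Rightarrow> 'm"

locale category =
  fixes C :: "('o, 'm) cat_data"
  assumes Dom_in: "u \<in> Arr C \<Longrightarrow> Dom C u \<in> Obj C"
    and Cod_in: "u \<in> Arr C \<Longrightarrow> Cod C u \<in> Obj C"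
    and Id_in: "a \<in> Obj C \<Longrightarrow> Id C a \<in> Arr C"
    and Dom_Id: "a \<in> Obj C \<Longrightarrow> Dom C (Id C a) = a"
    and Cod_Id: "a \<in> Obj C \<Longrightarrow> Cod C (Id C a) = a"
    and Comp_in: "\<lbrakk>u \<in> Arr C; v \<in> Arr C; Cod C u = Dom C v\<rbrakk> \<Longrightarrow> Comp C v u \<in> Arr C"
    and Dom_Comp: "\<lbrakk>u \<in> Arr C; v \<in> Arr C; Cod C u = Dom C v\<rbrakk> \<Longrightarrow> Dom C (Comp C v u) = Dom C u"
    and Cod_Comp: "\<lbrakk>u \<in> Arr C; v \<in> Arr C; Cod C u = Dom C v\<rbrakk> \<Longrightarrow> Cod C (Comp C v u) = Cod C v"
    and Comp_Id_right: "u \<in> Arr C \<Longrightarrow> Comp C u (Id C (Dom C u)) = u"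
    and Comp_Id_left: "u \<in> Arr C \<Longrightarrow> Comp C (Id C (Cod C u)) u = u"
    and Comp_assoc: "\<lbrakk>u \<in> Arr C; v \<in> Arr C; w \<in> Arr C; Cod C u = Dom C v; Cod C v = Dom C w\<rbrakk>
      \<Longrightarrow> Comp C w (Comp C v u) = Comp C (Comp C w v) u"

definition discrete_cat :: "('o, 'm) cat_data \<Rightarrow> bool" where
  "discrete_cat C \<longleftrightarrow> (\<forall>u \<in> Arr C. \<exists>a \<in> Obj C. u = Id C a)"

definition prod_cat ::
  "('oa, 'ma) cat_data \<Rightarrow> ('ob, 'mb) cat_data \<Rightarrow> ('oa \<times> 'ob, 'ma \<times> 'mb) cat_data" where
  "prod_cat A B =
    \<lparr> Obj = Obj A \<times> Obj B,
      Arr = Arr A \<times> Arr B,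
      Dom = (\<lambda>(u, v). (Dom A u, Dom B v)),
      Cod = (\<lambda>(u, v). (Cod A u, Cod B v)),
      Id = (\<lambda>(a, b). (Id A a, Id B b)),
      Comp = (\<lambda>(u', v') (u, v). (Comp A u' u, Comp B v' v)) \<rparr>"

section \<open>Functors and lenses\<close>

text \<open>The maps making up a functor or a lens are required to be extensional, that is, to take the
  value \<open>undefined\<close> outside their domain. Hence two lenses between the same
  categories are the same morphism if and only if they are equal in HOL.\<close>

record ('oa, 'ma, 'ob, 'mb) functor_data =
  fobj :: "'oa \<Rightarrow> 'ob"
  farr :: "'ma \<Rightarrow> 'mb"

locale cat_functor = A: category A + B: category B
  for A :: "('oa, 'ma) cat_data" and B :: "('ob, 'mb) cat_data" +
  fixes F :: "('oa, 'ma, 'ob, 'mb, 'z) functor_data_scheme"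
  assumes fobj_in: "fobj F \<in> Obj A \<rightarrow>\<^sub>E Obj B"
    and farr_in: "farr F \<in> Arr A \<rightarrow>\<^sub>E Arr B"
    and farr_Dom: "u \<in> Arr A \<Longrightarrow> Dom B (farr F u) = fobj F (Dom A u)"
    and farr_Cod: "u \<in> Arr A \<Longrightarrow> Cod B (farr F u) = fobj F (Cod A u)"
    and farr_Id: "a \<in> Obj A \<Longrightarrow> farr F (Id A a) = Id B (fobj F a)"
    and farr_Comp: "\<lbrakk>u \<in> Arr A; v \<in> Arr A; Cod A u = Dom A v\<rbrakk>
      \<Longrightarrow> farr F (Comp A v u) = Comp B (farr F v) (farr F u)"

record ('oa, 'ma, 'ob, 'mb) lens_data = "('oa, 'ma, 'ob, 'mb) functor_data" +
  lift :: "'oa \<times> 'mb \<Rightarrow> 'ma"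

definition lift_dom :: "('oa, 'ma) cat_data \<Rightarrow> ('ob, 'mb) cat_data \<Rightarrow> ('oa \<Rightarrow> 'ob) \<Rightarrow> ('oa \<times> 'mb) set"
  where "lift_dom A B f = {(a, u). a \<in> Obj A \<and> u \<in> Arr B \<and> Dom B u = f a}"

locale lens = cat_functor A B F
  for A :: "('oa, 'ma) cat_data" and B :: "('ob, 'mb) cat_data"
    and F :: "('oa, 'ma, 'ob, 'mb) lens_data" +
  assumes lift_in: "lift F \<in> lift_dom A B (fobj F) \<rightarrow>\<^sub>E Arr A"
    and Dom_lift: "(a, u) \<in> lift_dom A B (fobj F) \<Longrightarrow> Dom A (lift F (a, u)) = a"
    and farr_lift: "(a, u) \<in> lift_dom A B (fobj F) \<Longrightarrow> farr F (lift F (a, u)) = u"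
    and lift_Id: "a \<in> Obj A \<Longrightarrow> lift F (a, Id B (fobj F a)) = Id A a"
    and lift_Comp: "\<lbrakk>(a, u) \<in> lift_dom A B (fobj F); v \<in> Arr B; Cod B u = Dom B v\<rbrakk>
      \<Longrightarrow> lift F (a, Comp B v u) = Comp A (lift F (Cod A (lift F (a, u)), v)) (lift F (a, u))"

definition lens_id :: "('oa, 'ma) cat_data \<Rightarrow> ('oa, 'ma, 'oa, 'ma) lens_data" where
  "lens_id A =
    \<lparr> fobj = (\<lambda>a \<in> Obj A. a),
      farr = (\<lambda>u \<in> Arr A. u),
      lift = (\<lambda>(a, u) \<in> lift_dom A A (\<lambda>a. a). u) \<rparr>"

text \<open>\<open>lens_comp A C G F\<close> is the composite of \<open>F\<close> from \<open>A\<close> to \<open>B\<close> followed by \<open>G\<close> from \<open>B\<close> to \<open>C\<close>.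
  The categories \<open>A\<close> and \<open>C\<close> are only needed to delimit the domains of the resulting maps.\<close>

definition lens_comp ::
  "('oa, 'ma) cat_data \<Rightarrow> ('oc, 'mc) cat_data \<Rightarrow> ('ob, 'mb, 'oc, 'mc) lens_data
    \<Rightarrow> ('oa, 'ma, 'ob, 'mb) lens_data \<Rightarrow> ('oa, 'ma, 'oc, 'mc) lens_data" where
  "lens_comp A C G F =
    \<lparr> fobj = compose (Obj A) (fobj G) (fobj F),
      farr = compose (Arr A) (farr G) (farr F),
      lift = (\<lambda>(a, u) \<in> lift_dom A C (fobj G \<circ> fobj F). lift F (a, lift G (fobj F a, u))) \<rparr>"

text \<open>Small categories and lenses form a category.\<close>

lemma lens_lens_id:
  assumes "category A"
  shows "lens A A (lens_id A)"
proof -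
  interpret category A by fact
  show ?thesis
    by unfold_locales
      (auto simp: lens_id_def lift_dom_def Dom_in Cod_in Id_in Dom_Id Cod_Id Comp_in Dom_Comp Cod_Comp split: if_splits)
qed

lemma lens_lens_comp:
  assumes "lens A B F" and "lens B C G"
  shows "lens A C (lens_comp A C G F)"
proof -
  interpret F: lens A B F by fact
  interpret G: lens B C G by fact
  have fo[simp]: "fobj F a \<in> Obj B" if "a \<in> Obj A" for a using F.fobj_in that by auto
  have go[simp]: "fobj G a \<in> Obj C" if "a \<in> Obj B" for a using G.fobj_in that by auto
  have fa[simp]: "farr F a \<in> Arr B" if "a \<in> Arr A" for a using F.farr_in that by auto
  have ga[simp]: "farr G a \<in> Arr C" if "a \<in> Arr B" for a using G.farr_in that by auto
  have fl[simp]: "lift F (a,u) \<in> Arr A" if "a \<in> Obj A" "u \<in> Arr B" "Dom B u = fobj F a" for a u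
    using F.lift_in that by (auto simp: lift_dom_def PiE_iff)
  have gl[simp]: "lift G (a,u) \<in> Arr B" if "a \<in> Obj B" "u \<in> Arr C" "Dom C u = fobj G a" for a u
    using G.lift_in that by (auto simp: lift_dom_def PiE_iff)
  have fd[simp]: "Dom A (lift F (a,u)) = a" "farr F (lift F (a,u)) = u" "fobj F (Cod A (lift F (a,u))) = Cod B u"
    if "a \<in> Obj A" "u \<in> Arr B" "Dom B u = fobj F a" for a u
    using that F.Dom_lift[of a u] F.farr_lift[of a u] F.farr_Cod[of "lift F (a,u)"] by (auto simp: lift_dom_def)
  have gd[simp]: "Dom B (lift G (a,u)) = a" "farr G (lift G (a,u)) = u" "fobj G (Cod B (lift G (a,u))) = Cod C u"
    if "a \<in> Obj B" "u \<in> Arr C" "Dom C u = fobj G a" for a u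
    using that G.Dom_lift[of a u] G.farr_lift[of a u] G.farr_Cod[of "lift G (a,u)"] by (auto simp: lift_dom_def)
  note [simp] = F.A.Dom_in F.A.Cod_in F.B.Dom_in F.B.Cod_in G.B.Dom_in G.B.Cod_in
    F.A.Id_in F.A.Comp_in F.B.Id_in F.B.Comp_in  G.B.Id_in G.B.Comp_in
    F.farr_Dom F.farr_Cod F.farr_Id F.farr_Comp G.farr_Dom G.farr_Cod G.farr_Id G.farr_Comp
    F.lift_Id G.lift_Id G.B.Dom_Id G.B.Dom_Comp F.B.Dom_Comp
  show ?thesis
    apply unfold_locales
    apply (auto simp: lens_comp_def compose_def lift_dom_def split: if_splits)
    apply (subst G.lift_Comp, auto simp: lift_dom_def)
    apply (subst F.lift_Comp, auto simp: lift_dom_def)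
    done
qed

lemma lens_comp_id_left:
  assumes "lens A B F"
  shows "lens_comp A B (lens_id B) F = F"
proof -
  interpret F: lens A B F by fact
  have [simp]: "Dom A (lift F (a,u)) = a" if "a \<in> Obj A" "u \<in> Arr B" "Dom B u = fobj F a" for a u using F.Dom_lift that by (auto simp: lift_dom_def)
  show ?thesis using F.fobj_in F.farr_in F.lift_in
    apply (intro lens_data.equality)
    apply (auto simp: lens_comp_def lens_id_def compose_def fun_eq_iff PiE_iff extensional_def lift_dom_def restrict_def)
    done
qed

lemma lens_comp_id_right:
  assumes "lens A B F"
  shows "lens_comp A B F (lens_id A) = F"
proof -
  interpret F: lens A B F by fact
  have [simp]: "Dom A (lift F (a,u)) = a" if "a \<in> Obj A" "u \<in> Arr B" "Dom B u = fobj F a" for a u using F.Dom_lift that by (auto simp: lift_dom_def)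
  show ?thesis using F.fobj_in F.farr_in F.lift_in
    apply (intro lens_data.equality)
    apply (auto simp: lens_comp_def lens_id_def compose_def fun_eq_iff PiE_iff extensional_def lift_dom_def restrict_def F.Dom_lift[unfolded lift_dom_def])
    done
qed

lemma lens_comp_assoc:
  assumes "lens A B F" and "lens B C G" and "lens C D H"
  shows "lens_comp A D H (lens_comp A C G F) = lens_comp A D (lens_comp B D H G) F"
proof -
  interpret F: lens A B F by fact
  interpret G: lens B C G by fact
  interpret H: lens C D H by fact
  have fo[simp]: "fobj F a \<in> Obj B" if "a \<in> Obj A" for a using F.fobj_in that by auto
  have go[simp]: "fobj G a \<in> Obj C" if "a \<in> Obj B" for a using G.fobj_in that by auto
  have fa[simp]: "farr F a \<in> Arr B" if "a \<in> Arr A" for a using F.farr_in that by auto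
  have hl[simp]: "lift H (a,u) \<in> Arr C" "Dom C (lift H (a,u)) = a" if "a \<in> Obj C" "u \<in> Arr D" "Dom D u = fobj H a" for a u
    using H.lift_in H.Dom_lift[of a u] that by (auto simp: lift_dom_def PiE_iff)
  show ?thesis
    apply (intro lens_data.equality)
    apply (auto simp: lens_comp_def compose_def fun_eq_iff lift_dom_def restrict_def)
    done
qed

section \<open>The imported product and the universal property of products\<close>

definition proj0 ::
  "('oa, 'ma) cat_data \<Rightarrow> ('ob, 'mb) cat_data \<Rightarrow> ('oa \<times> 'ob, 'ma \<times> 'mb, 'oa, 'ma) lens_data" where
  "proj0 A B =
    \<lparr> fobj = restrict fst (Obj A \<times> Obj B),
      farr = restrict fst (Arr A \<times> Arr B),
      lift = (\<lambda>((a, b), u) \<in> lift_dom (prod_cat A B) A fst. (u, Id B b)) \<rparr>"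

definition proj1 ::
  "('oa, 'ma) cat_data \<Rightarrow> ('ob, 'mb) cat_data \<Rightarrow> ('oa \<times> 'ob, 'ma \<times> 'mb, 'ob, 'mb) lens_data" where
  "proj1 A B =
    \<lparr> fobj = restrict snd (Obj A \<times> Obj B),
      farr = restrict snd (Arr A \<times> Arr B),
      lift = (\<lambda>((a, b), v) \<in> lift_dom (prod_cat A B) B snd. (Id A a, v)) \<rparr>"

text \<open>The universal property of a product in the category of small categories and lenses. A HOL
  formula cannot quantify over types, so the types of the objects and arrows of the apex \<open>X\<close> of a
  competing cone are a parameter, given by the \<open>itself\<close> argument. The full
  universal property is obtained by leaving these types arbitrary, as type variables of
  a theorem.\<close>

definition lens_product_cone ::
  "('ox, 'mx) cat_data itself \<Rightarrow> ('oa, 'ma) cat_data \<Rightarrow> ('ob, 'mb) cat_data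
    \<Rightarrow> ('op, 'mp) cat_data \<Rightarrow> ('op, 'mp, 'oa, 'ma) lens_data \<Rightarrow> ('op, 'mp, 'ob, 'mb) lens_data
    \<Rightarrow> bool" where
  "lens_product_cone (_ :: ('ox, 'mx) cat_data itself) A B P p0 p1 \<longleftrightarrow>
    lens P A p0 \<and> lens P B p1 \<and>
    (\<forall>(X :: ('ox, 'mx) cat_data) F G. lens X A F \<and> lens X B G \<longrightarrow>
      (\<exists>!H. lens X P H \<and> lens_comp X A p0 H = F \<and> lens_comp X B p1 H = G))"

end

theory Submission
  imports Defs
begin

text \<open>An arrow of the product factors as \<open>(u, v) = (u, 1) \<circ> (1, v)\<close>, and the two factors are lifts
  along the projections. Hence the lifting operation of a mediating lens into \<open>A \<times> B\<close> can only be
  "lift \<open>v\<close> along \<open>G\<close>, then lift \<open>u\<close> along \<open>F\<close>", for arbitrary \<open>A\<close> and \<open>B\<close>.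
  Conversely, this recipe is a lens over \<open>\<langle>F, G\<rangle>\<close> as soon as each of \<open>F\<close> and \<open>G\<close> sends the lifts of
  the other to identities and lifts along \<open>F\<close> commute with lifts along \<open>G\<close>. If one of the
  factors is discrete, then all lifts along the lens into it are identities, so that these
  conditions hold trivially.\<close>

section \<open>Product categories, discrete categories and basic facts on lenses\<close>

lemma prod_cat_simps [simp]:
  "Obj (prod_cat A B) = Obj A \<times> Obj B"
  "Arr (prod_cat A B) = Arr A \<times> Arr B"
  "Dom (prod_cat A B) (u, v) = (Dom A u, Dom B v)"
  "Cod (prod_cat A B) (u, v) = (Cod A u, Cod B v)"
  "Id (prod_cat A B) (a, b) = (Id A a, Id B b)"
  "Comp (prod_cat A B) (u', v') (u, v) = (Comp A u' u, Comp B v' v)"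
  by (simp_all add: prod_cat_def)

lemmas (in category) category_simps =
  Dom_in Cod_in Id_in Dom_Id Cod_Id Comp_in Dom_Comp Cod_Comp Comp_Id_right Comp_Id_left

text \<open>Lifts along a projection carry an identity in the other component, where their
  composition law reduces to this equation.\<close>

lemma (in category) Comp_Id_Id: "a \<in> Obj C \<Longrightarrow> Comp C (Id C a) (Id C a) = Id C a"
  using Comp_Id_left[of "Id C a"] by (simp add: category_simps)

lemma (in category) discrete_arr_eq_Id:
  assumes "discrete_cat C" "u \<in> Arr C"
  shows "u = Id C (Dom C u)"
  using assms by (auto simp: discrete_cat_def Dom_Id)

lemma category_prod_cat:
  assumes "category A" "category B"
  shows "category (prod_cat A B)"
proof -
  interpret A: category A by fact
  interpret B: category B by fact
  show ?thesis
    by unfold_locales (auto simp: A.category_simps B.category_simps A.Comp_assoc B.Comp_assoc)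
qed

context lens
begin

lemma fobj_Obj: "a \<in> Obj A \<Longrightarrow> fobj F a \<in> Obj B"
  using fobj_in by auto

lemma farr_Arr: "u \<in> Arr A \<Longrightarrow> farr F u \<in> Arr B"
  using farr_in by auto

lemma
  assumes "a \<in> Obj A" "u \<in> Arr B" "Dom B u = fobj F a"
  shows lift_Arr: "lift F (a, u) \<in> Arr A"
    and Dom_lift': "Dom A (lift F (a, u)) = a"
    and farr_lift': "farr F (lift F (a, u)) = u"
    and fobj_Cod_lift: "fobj F (Cod A (lift F (a, u))) = Cod B u"
proof -
  have "(a, u) \<in> lift_dom A B (fobj F)"
    using assms by (simp add: lift_dom_def)
  then show *: "lift F (a, u) \<in> Arr A" and "Dom A (lift F (a, u)) = a"
    and **: "farr F (lift F (a, u)) = u"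
    using lift_in Dom_lift farr_lift by (auto simp: PiE_iff)
  show "fobj F (Cod A (lift F (a, u))) = Cod B u"
    using farr_Cod[OF *] ** by simp
qed

lemma lift_Comp':
  assumes "a \<in> Obj A" "u \<in> Arr B" "Dom B u = fobj F a" "v \<in> Arr B" "Cod B u = Dom B v"
  shows "lift F (a, Comp B v u) = Comp A (lift F (Cod A (lift F (a, u)), v)) (lift F (a, u))"
  using assms by (intro lift_Comp) (auto simp: lift_dom_def)

lemmas lens_simps = fobj_Obj farr_Arr farr_Dom farr_Cod farr_Id farr_Comp
  lift_Arr Dom_lift' farr_lift' fobj_Cod_lift lift_Id

text \<open>Discreteness forces \<open>u\<close> to be the identity of its domain
  \<open>fobj F a\<close>, and a lens lifts identities to identities.\<close>

lemma discrete_lift_eq_Id: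
  assumes "discrete_cat B" "a \<in> Obj A" "u \<in> Arr B" "Dom B u = fobj F a"
  shows "lift F (a, u) = Id A a"
  using lift_Id[of a] B.discrete_arr_eq_Id[of u] assms by simp

end

section \<open>The product projections are lenses\<close>

lemma lens_proj0:
  assumes "category A" "category B"
  shows "lens (prod_cat A B) A (proj0 A B)"
proof -
  interpret A: category A by fact
  interpret B: category B by fact
  interpret P: category "prod_cat A B" by (rule category_prod_cat) fact+
  show ?thesis
    by unfold_locales
      (auto simp: proj0_def lift_dom_def A.category_simps B.category_simps B.Comp_Id_Id
        split: if_splits)
qed

lemma lens_proj1:
  assumes "category A" "category B"
  shows "lens (prod_cat A B) B (proj1 A B)"
proof -
  interpret A: category A by fact
  interpret B: category B by fact
  interpret P: category "prod_cat A B" by (rule category_prod_cat) fact+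
  show ?thesis
    by unfold_locales
      (auto simp: proj1_def lift_dom_def A.category_simps B.category_simps A.Comp_Id_Id
        split: if_splits)
qed

section \<open>Uniqueness: a lens into the product category is determined by its two
  composites\<close>

locale lens_into_prod = H: lens X "prod_cat A B" H + A: category A + B: category B
  for X :: "('ox, 'mx) cat_data" and A :: "('oa, 'ma) cat_data" and B :: "('ob, 'mb) cat_data"
    and H :: "('ox, 'mx, 'oa \<times> 'ob, 'ma \<times> 'mb) lens_data"
begin

text \<open>The restriction to \<open>Obj X\<close> matters: outside it \<open>fobj H\<close> yields
  \<open>undefined\<close>, which need not be the pair of two \<open>undefined\<close>
  values.\<close>

lemma fobj_eq_pair:
  "fobj H = (\<lambda>x \<in> Obj X.
    (fobj (lens_comp X A (proj0 A B) H) x, fobj (lens_comp X B (proj1 A B) H) x))"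
  using H.fobj_in
  by (auto simp: fun_eq_iff lens_comp_def proj0_def proj1_def compose_def PiE_iff extensional_def
      mem_Times_iff)

lemma farr_eq_pair:
  "farr H = (\<lambda>u \<in> Arr X.
    (farr (lens_comp X A (proj0 A B) H) u, farr (lens_comp X B (proj1 A B) H) u))"
  using H.farr_in
  by (auto simp: fun_eq_iff lens_comp_def proj0_def proj1_def compose_def PiE_iff extensional_def
      mem_Times_iff)

lemma lift_proj0_comp:
  assumes "x \<in> Obj X" "fobj H x = (a, b)" "u \<in> Arr A" "Dom A u = a"
  shows "lift (lens_comp X A (proj0 A B) H) (x, u) = lift H (x, (u, Id B b))"
  using assms H.fobj_Obj[of x] by (auto simp: lens_comp_def proj0_def lift_dom_def)

lemma lift_proj1_comp:
  assumes "x \<in> Obj X" "fobj H x = (a, b)" "v \<in> Arr B" "Dom B v = b"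
  shows "lift (lens_comp X B (proj1 A B) H) (x, v) = lift H (x, (Id A a, v))"
  using assms H.fobj_Obj[of x] by (auto simp: lens_comp_def proj1_def lift_dom_def)

text \<open>The law \<open>lift_Comp\<close> of \<open>H\<close> splits the lift along the
  factorization of \<open>(u, v)\<close>, and each half is a lift along a composite with a
  projection. The right side thus depends on \<open>H\<close> only through these composites.\<close>

lemma lift_eq_Comp:
  assumes x: "x \<in> Obj X" "fobj H x = (a, b)" and u: "u \<in> Arr A" "Dom A u = a"
    and v: "v \<in> Arr B" "Dom B v = b"
  defines "l \<equiv> lift (lens_comp X B (proj1 A B) H) (x, v)"
  shows "lift H (x, (u, v)) = Comp X (lift (lens_comp X A (proj0 A B) H) (Cod X l, u)) l"
proof -
  have a: "a \<in> Obj A" and b: "b \<in> Obj B"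
    using u v by (auto simp: A.Dom_in B.Dom_in)
  have l: "l = lift H (x, (Id A a, v))"
    unfolding l_def using x v by (rule lift_proj1_comp)
  have D: "Dom (prod_cat A B) (Id A a, v) = fobj H x" "(Id A a, v) \<in> Arr (prod_cat A B)"
    using x v a by (simp_all add: A.category_simps)
  \<comment> \<open>The lift of \<open>(Id A a, v)\<close> ends over \<open>(a, Cod B v)\<close>, so
    \<open>u\<close> can still be lifted there, next to the identity of
    \<open>Cod B v\<close>.\<close>
  have y: "Cod X l \<in> Obj X" "fobj H (Cod X l) = (a, Cod B v)"
    using x D H.lift_Arr[of x "(Id A a, v)"] H.fobj_Cod_lift[of x "(Id A a, v)"] a
    by (simp_all add: l A.category_simps H.A.Cod_in)
  have "(u, v) = Comp (prod_cat A B) (u, Id B (Cod B v)) (Id A a, v)"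
    using u v A.Comp_Id_right[of u] by (simp add: B.Comp_Id_left)
  then have "lift H (x, (u, v)) = Comp X (lift H (Cod X l, (u, Id B (Cod B v)))) l"
    using x D u v a
    by (simp only: l, subst H.lift_Comp') (simp_all add: A.category_simps B.category_simps)
  also have "lift H (Cod X l, (u, Id B (Cod B v)))
      = lift (lens_comp X A (proj0 A B) H) (Cod X l, u)"
    using y u by (simp add: lift_proj0_comp)
  finally show ?thesis .
qed

end

text \<open>The composites determine the object and arrow maps componentwise, and
  \<open>lift_eq_Comp\<close> recovers the lifts.\<close>

lemma proj_jointly_monic:
  assumes "category A" "category B" "lens X (prod_cat A B) H" "lens X (prod_cat A B) K"
    and 0: "lens_comp X A (proj0 A B) H = lens_comp X A (proj0 A B) K"
    and 1: "lens_comp X B (proj1 A B) H = lens_comp X B (proj1 A B) K"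
  shows "H = K"
proof -
  interpret A: category A by fact
  interpret B: category B by fact
  interpret H: lens X "prod_cat A B" H by fact
  interpret K: lens X "prod_cat A B" K by fact
  interpret H: lens_into_prod X A B H by unfold_locales
  interpret K: lens_into_prod X A B K by unfold_locales
  have fobj: "fobj H = fobj K"
    by (simp add: H.fobj_eq_pair K.fobj_eq_pair 0 1)
  have farr: "farr H = farr K"
    by (simp add: H.farr_eq_pair K.farr_eq_pair 0 1)
  have "lift H = lift K"
  \<comment> \<open>Comparing the lifts as extensional maps requires one common domain, hence the
    folding with \<open>fobj\<close>.\<close>
  proof (rule PiE_ext[OF H.lift_in K.lift_in[folded fobj]])
    fix xw assume "xw \<in> lift_dom X (prod_cat A B) (fobj H)"
    then obtain x u v where xw: "xw = (x, (u, v))" and x: "x \<in> Obj X"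
      and w: "u \<in> Arr A" "v \<in> Arr B" "fobj H x = (Dom A u, Dom B v)"
      by (auto simp: lift_dom_def)
    show "lift H xw = lift K xw"
      using H.lift_eq_Comp[OF x w(3) w(1) refl w(2) refl]
        K.lift_eq_Comp[OF x w(3)[unfolded fobj] w(1) refl w(2) refl]
      by (simp add: xw 0 1)
  qed
  then show ?thesis
    using fobj farr by simp
qed

section \<open>Existence: pairing two commuting lenses\<close>

locale lens_span = F: lens X A F + G: lens X B G
  for X :: "('ox, 'mx) cat_data" and A :: "('oa, 'ma) cat_data" and B :: "('ob, 'mb) cat_data"
    and F :: "('ox, 'mx, 'oa, 'ma) lens_data" and G :: "('ox, 'mx, 'ob, 'mb) lens_data"
begin

text \<open>The order, first along \<open>G\<close> and then along \<open>F\<close>, is the one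
  forced by \<open>lift_eq_Comp\<close>. The unrestricted pairing is harmless in the domain, since
  \<open>lift_dom\<close> only contains pairs with \<open>x\<close> in \<open>Obj X\<close>.\<close>

definition pair :: "('ox, 'mx, 'oa \<times> 'ob, 'ma \<times> 'mb) lens_data" where
  "pair =
    \<lparr> fobj = (\<lambda>x \<in> Obj X. (fobj F x, fobj G x)),
      farr = (\<lambda>w \<in> Arr X. (farr F w, farr G w)),
      lift = (\<lambda>(x, (u, v)) \<in> lift_dom X (prod_cat A B) (\<lambda>x. (fobj F x, fobj G x)).
        Comp X (lift F (Cod X (lift G (x, v)), u)) (lift G (x, v))) \<rparr>"

end

text \<open>By the first two conditions, a lift along one leg stays over the same object of the
  other leg. Hence all lifts in \<open>lift_commute\<close> are defined, and \<open>pair\<close>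
  lifts \<open>(u, v)\<close> to an arrow over \<open>(u, v)\<close>. The third condition serves the
  composition law.\<close>

locale commuting_lens_span = lens_span +
  assumes farr_G_lift_F: "\<lbrakk>x \<in> Obj X; u \<in> Arr A; Dom A u = fobj F x\<rbrakk>
      \<Longrightarrow> farr G (lift F (x, u)) = Id B (fobj G x)"
    and farr_F_lift_G: "\<lbrakk>x \<in> Obj X; v \<in> Arr B; Dom B v = fobj G x\<rbrakk>
      \<Longrightarrow> farr F (lift G (x, v)) = Id A (fobj F x)"
    and lift_commute: "\<lbrakk>x \<in> Obj X; u \<in> Arr A; Dom A u = fobj F x; v \<in> Arr B; Dom B v = fobj G x\<rbrakk>
      \<Longrightarrow> Comp X (lift F (Cod X (lift G (x, v)), u)) (lift G (x, v))
        = Comp X (lift G (Cod X (lift F (x, u)), v)) (lift F (x, u))"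
begin

lemma fobj_F_Cod_lift_G:
  assumes "x \<in> Obj X" "v \<in> Arr B" "Dom B v = fobj G x"
  shows "fobj F (Cod X (lift G (x, v))) = fobj F x"
  using assms F.farr_Cod[of "lift G (x, v)"]
  by (simp add: farr_F_lift_G G.lens_simps F.lens_simps F.B.category_simps)

lemma fobj_G_Cod_lift_F:
  assumes "x \<in> Obj X" "u \<in> Arr A" "Dom A u = fobj F x"
  shows "fobj G (Cod X (lift F (x, u))) = fobj G x"
  using assms G.farr_Cod[of "lift F (x, u)"]
  by (simp add: farr_G_lift_F G.lens_simps F.lens_simps G.B.category_simps)

lemmas span_simps = F.lens_simps G.lens_simps farr_G_lift_F farr_F_lift_G
  fobj_F_Cod_lift_G fobj_G_Cod_lift_F
  F.A.category_simps F.B.category_simps G.B.category_simps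

text \<open>By \<open>lift_Comp\<close> for \<open>F\<close> and \<open>G\<close>, the left side is
  the path \<open>g\<close>, \<open>g'\<close>, \<open>f'\<close>, \<open>k\<close>, while the right
  side is \<open>g\<close>, \<open>f\<close>, \<open>h\<close>, \<open>k\<close>. The two differ by
  a commuting square at \<open>y\<close>.\<close>

lemma lift_pair_Comp:
  assumes x: "x \<in> Obj X"
    and u: "u \<in> Arr A" "Dom A u = fobj F x" "u' \<in> Arr A" "Cod A u = Dom A u'"
    and v: "v \<in> Arr B" "Dom B v = fobj G x" "v' \<in> Arr B" "Cod B v = Dom B v'"
  defines "L \<equiv> \<lambda>x u v. Comp X (lift F (Cod X (lift G (x, v)), u)) (lift G (x, v))"
  shows "L x (Comp A u' u) (Comp B v' v) = Comp X (L (Cod X (L x u v)) u' v') (L x u v)"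
proof -
  \<comment> \<open>The square has sides \<open>f\<close> then \<open>h\<close>, and
    \<open>g'\<close> then \<open>f'\<close>: both lift \<open>u\<close> along \<open>F\<close> and
    \<open>v'\<close> along \<open>G\<close>, in opposite orders.\<close>
  define g where "g = lift G (x, v)"
  define y where "y = Cod X g"
  define f where "f = lift F (y, u)"
  define z where "z = Cod X f"
  define g' where "g' = lift G (y, v')"
  define w where "w = Cod X g'"
  define f' where "f' = lift F (w, u)"
  define h where "h = lift G (z, v')"
  define k where "k = lift F (Cod X h, u')"
  have g: "g \<in> Arr X" "Dom X g = x" "Cod X g = y"
    and y: "y \<in> Obj X" "fobj F y = fobj F x" "fobj G y = Cod B v"
    using x v by (simp_all add: y_def g_def span_simps)
  have f: "f \<in> Arr X" "Dom X f = y" "Cod X f = z"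
    and z: "z \<in> Obj X" "fobj F z = Cod A u" "fobj G z = Cod B v"
    using y u by (simp_all add: z_def f_def span_simps)
  have g': "g' \<in> Arr X" "Dom X g' = y" "Cod X g' = w"
    and w: "w \<in> Obj X" "fobj F w = fobj F x" "fobj G w = Cod B v'"
    using y v by (simp_all add: w_def g'_def span_simps)
  have f': "f' \<in> Arr X" "Dom X f' = w"
    using w u by (simp_all add: f'_def span_simps)
  have h: "h \<in> Arr X" "Dom X h = z"
    and Ch: "Cod X h \<in> Obj X" "fobj F (Cod X h) = Cod A u"
    using z v by (simp_all add: h_def span_simps)
  have k: "k \<in> Arr X" "Dom X k = Cod X h"
    using Ch u by (simp_all add: k_def span_simps)
  have comm: "Comp X f' g' = Comp X h f"
    using lift_commute[of y u v'] y u v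
    by (simp add: f'_def g'_def w_def h_def z_def f_def)
  \<comment> \<open>\<open>f'\<close> starts at \<open>w\<close> and \<open>h\<close> at
    \<open>z\<close>; only the square shows that they end at the same object, so that
    \<open>k\<close> can follow \<open>f'\<close>.\<close>
  have Cod: "Cod X f' = Cod X h"
    using arg_cong[OF comm, of "Cod X"] f f' g' h by (simp add: F.A.Cod_Comp)
  have L1: "L x u v = Comp X f g"
    by (simp add: L_def f_def y_def g_def)
  have CL1: "Cod X (L x u v) = z"
    using f g by (simp add: L1 F.A.Cod_Comp)
  have gg: "lift G (x, Comp B v' v) = Comp X g' g"
    using x v by (simp add: G.lift_Comp' g'_def y_def g_def)
  have Cgg: "Cod X (Comp X g' g) = w"
    using g g' by (simp add: F.A.Cod_Comp)
  have ff: "lift F (w, Comp A u' u) = Comp X k f'"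
    using w u Cod by (simp add: F.lift_Comp' f'_def k_def)
  have "L x (Comp A u' u) (Comp B v' v) = Comp X (Comp X k f') (Comp X g' g)"
    by (simp add: L_def gg Cgg ff)
  also have "\<dots> = Comp X k (Comp X (Comp X f' g') g)"
    using k f' g g' Cod F.A.Comp_assoc[symmetric] by (simp add: span_simps)
  also have "\<dots> = Comp X (Comp X k h) (Comp X f g)"
    using k h f g F.A.Comp_assoc[symmetric] by (simp add: span_simps comm)
  also have "\<dots> = Comp X (L z u' v') (L x u v)"
    by (simp add: L1) (simp add: L_def k_def h_def)
  finally show ?thesis
    by (simp add: CL1)
qed

lemma lift_pair:
  assumes "x \<in> Obj X" "u \<in> Arr A" "Dom A u = fobj F x" "v \<in> Arr B" "Dom B v = fobj G x"
  shows "lift pair (x, (u, v)) = Comp X (lift F (Cod X (lift G (x, v)), u)) (lift G (x, v))"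
  using assms by (simp add: pair_def lift_dom_def)

lemma lens_pair: "lens X (prod_cat A B) pair"
proof -
  interpret P: category "prod_cat A B"
    by (intro category_prod_cat F.B.category_axioms G.B.category_axioms)
  have fobj: "fobj pair = (\<lambda>x \<in> Obj X. (fobj F x, fobj G x))"
    and farr: "farr pair = (\<lambda>w \<in> Arr X. (farr F w, farr G w))"
    by (simp_all add: pair_def)
  interpret cat_functor X "prod_cat A B" pair
    by unfold_locales (auto simp: fobj farr span_simps)
  have lift_in: "lift pair \<in> lift_dom X (prod_cat A B) (fobj pair) \<rightarrow>\<^sub>E Arr X"
    by (auto simp: pair_def lift_dom_def span_simps split: if_splits)
  show ?thesis
  proof (unfold_locales, rule lift_in)
    fix a w assume "(a, w) \<in> lift_dom X (prod_cat A B) (fobj pair)"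
    then obtain u v where w: "w = (u, v)"
      "a \<in> Obj X" "u \<in> Arr A" "Dom A u = fobj F a" "v \<in> Arr B" "Dom B v = fobj G a"
      by (auto simp: lift_dom_def fobj)
    \<comment> \<open>\<open>F\<close> sends the composite lift to \<open>u\<close> after an
      identity, and \<open>G\<close> sends it to an identity after \<open>v\<close>.\<close>
    then show "Dom X (lift pair (a, w)) = a" "farr pair (lift pair (a, w)) = w"
      by (simp_all add: lift_pair farr span_simps)
        (use F.B.Comp_Id_right[of u] G.B.Comp_Id_left[of v] in simp)
    fix w' assume "w' \<in> Arr (prod_cat A B)" "Cod (prod_cat A B) w = Dom (prod_cat A B) w'"
    then obtain u' v' where w': "w' = (u', v')"
      "u' \<in> Arr A" "Cod A u = Dom A u'" "v' \<in> Arr B" "Cod B v = Dom B v'"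
      by (cases w') (auto simp: w)
    have l: "lift pair (a, w) \<in> Arr X" "fobj pair (Cod X (lift pair (a, w))) = (Cod A u, Cod B v)"
      using w by (simp_all add: lift_pair fobj span_simps)
    have "lift pair (a, Comp (prod_cat A B) w' w)
        = lift pair (a, (Comp A u' u, Comp B v' v))"
      by (simp add: w w')
    also have "\<dots> = Comp X (lift pair (Cod X (lift pair (a, w)), w')) (lift pair (a, w))"
      using w w' l by (simp add: lift_pair lift_pair_Comp span_simps)
    finally show "lift pair (a, Comp (prod_cat A B) w' w)
        = Comp X (lift pair (Cod X (lift pair (a, w)), w')) (lift pair (a, w))" .
  next
    fix a assume "a \<in> Obj X"
    then show "lift pair (a, Id (prod_cat A B) (fobj pair a)) = Id X a"
      by (simp add: fobj lift_pair span_simps F.A.Comp_Id_Id)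
  qed
qed

text \<open>On lifts: the second component is an identity, whose lift along \<open>G\<close> is an
  identity by \<open>lift_Id\<close>; what remains is the lift along \<open>F\<close>.\<close>

lemma proj0_pair: "lens_comp X A (proj0 A B) pair = F"
proof -
  interpret P: lens X "prod_cat A B" pair by (rule lens_pair)
  interpret P: lens_into_prod X A B pair by unfold_locales
  interpret C: lens X A "lens_comp X A (proj0 A B) pair"
    by (rule lens_lens_comp[OF lens_pair lens_proj0])
      (rule F.B.category_axioms G.B.category_axioms)+
  have fobj: "fobj (lens_comp X A (proj0 A B) pair) = fobj F"
    using F.fobj_in
    by (auto simp: fun_eq_iff lens_comp_def proj0_def pair_def compose_def PiE_iff
        extensional_def span_simps)
  have farr: "farr (lens_comp X A (proj0 A B) pair) = farr F"
    using F.farr_in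
    by (auto simp: fun_eq_iff lens_comp_def proj0_def pair_def compose_def PiE_iff
        extensional_def span_simps)
  have "lift (lens_comp X A (proj0 A B) pair) = lift F"
  proof (rule PiE_ext[OF C.lift_in F.lift_in[folded fobj]])
    fix xu assume "xu \<in> lift_dom X A (fobj (lens_comp X A (proj0 A B) pair))"
    then obtain x u where x: "xu = (x, u)" "x \<in> Obj X" "u \<in> Arr A" "Dom A u = fobj F x"
      unfolding fobj by (auto simp: lift_dom_def)
    then have "fobj pair x = (fobj F x, fobj G x)"
      by (simp add: pair_def)
    then have "lift (lens_comp X A (proj0 A B) pair) (x, u) = lift pair (x, (u, Id B (fobj G x)))"
      using x by (simp add: P.lift_proj0_comp)
    also have "\<dots> = lift F (x, u)"
      using x F.A.Comp_Id_right[of "lift F (x, u)"] by (simp add: lift_pair span_simps)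
    finally show "lift (lens_comp X A (proj0 A B) pair) xu = lift F xu"
      by (simp add: x)
  qed
  then show ?thesis
    using fobj farr by simp
qed

lemma proj1_pair: "lens_comp X B (proj1 A B) pair = G"
proof -
  interpret P: lens X "prod_cat A B" pair by (rule lens_pair)
  interpret P: lens_into_prod X A B pair by unfold_locales
  interpret C: lens X B "lens_comp X B (proj1 A B) pair"
    by (rule lens_lens_comp[OF lens_pair lens_proj1])
      (rule F.B.category_axioms G.B.category_axioms)+
  have fobj: "fobj (lens_comp X B (proj1 A B) pair) = fobj G"
    using G.fobj_in
    by (auto simp: fun_eq_iff lens_comp_def proj1_def pair_def compose_def PiE_iff
        extensional_def span_simps)
  have farr: "farr (lens_comp X B (proj1 A B) pair) = farr G"
    using G.farr_in
    by (auto simp: fun_eq_iff lens_comp_def proj1_def pair_def compose_def PiE_iff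
        extensional_def span_simps)
  have "lift (lens_comp X B (proj1 A B) pair) = lift G"
  proof (rule PiE_ext[OF C.lift_in G.lift_in[folded fobj]])
    fix xu assume "xu \<in> lift_dom X B (fobj (lens_comp X B (proj1 A B) pair))"
    then obtain x u where x: "xu = (x, u)" "x \<in> Obj X" "u \<in> Arr B" "Dom B u = fobj G x"
      unfolding fobj by (auto simp: lift_dom_def)
    then have "fobj pair x = (fobj F x, fobj G x)"
      by (simp add: pair_def)
    then have "lift (lens_comp X B (proj1 A B) pair) (x, u) = lift pair (x, (Id A (fobj F x), u))"
      using x by (simp add: P.lift_proj1_comp)
    \<comment> \<open>The identity of \<open>fobj F x\<close> is lifted along \<open>F\<close> from
      the codomain of the lift along \<open>G\<close>. By \<open>fobj_F_Cod_lift_G\<close> that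
      codomain still lies over \<open>fobj F x\<close>, so \<open>F.lift_Id\<close> applies.\<close>
    also have "\<dots> = lift G (x, u)"
      using x F.lift_Id[of "Cod X (lift G (x, u))"] by (simp add: lift_pair span_simps)
    finally show "lift (lens_comp X B (proj1 A B) pair) xu = lift G xu"
      by (simp add: x)
  qed
  then show ?thesis
    using fobj farr by simp
qed

end

section \<open>Spans with a discrete factor, and the universal property\<close>

lemma (in lens_span) commuting_if_discrete:
  assumes "discrete_cat A \<or> discrete_cat B"
  shows "commuting_lens_span X A B F G"
  using assms
proof
  assume A: "discrete_cat A"
  note [simp] = F.discrete_lift_eq_Id[OF A] F.lens_simps G.lens_simps F.A.category_simps
  show ?thesis
  proof (unfold_locales, goal_cases)
    \<comment> \<open>Any arrow of \<open>A\<close> is the identity of its domain, here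
      \<open>fobj F x\<close>.\<close>
    case (2 x v)
    then show ?case
      using F.B.discrete_arr_eq_Id[OF A, of "farr F (lift G (x, v))"] by simp
  next
    \<comment> \<open>Both sides reduce to \<open>lift G (x, v)\<close>. On the left,
      \<open>u\<close> must first be seen to start at the object under the end of that lift.\<close>
    case (3 x u v)
    then have "fobj F (Cod X (lift G (x, v))) = fobj F x"
      using F.B.discrete_arr_eq_Id[OF A, of "farr F (lift G (x, v))"]
        F.farr_Cod[of "lift G (x, v)"] F.B.Cod_Id[of "fobj F x"] by simp
    with 3 show ?case
      using F.A.Comp_Id_right[of "lift G (x, v)"] by simp
  qed simp
next
  assume B: "discrete_cat B"
  note [simp] = G.discrete_lift_eq_Id[OF B] F.lens_simps G.lens_simps F.A.category_simps
  show ?thesis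
  proof (unfold_locales, goal_cases)
    case (1 x u)
    then show ?case
      using G.B.discrete_arr_eq_Id[OF B, of "farr G (lift F (x, u))"] by simp
  next
    case (3 x u v)
    then have "fobj G (Cod X (lift F (x, u))) = fobj G x"
      using G.B.discrete_arr_eq_Id[OF B, of "farr G (lift F (x, u))"]
        G.farr_Cod[of "lift F (x, u)"] G.B.Cod_Id[of "fobj G x"] by simp
    with 3 show ?case
      using F.A.Comp_Id_right[of "lift F (x, u)"] by simp
  qed simp
qed

theorem proposition5p3:
  fixes A :: "('oa, 'ma) cat_data" and B :: "('ob, 'mb) cat_data"
  assumes "category A" and "category B"
    and "discrete_cat A \<or> discrete_cat B"
  shows "lens_product_cone TYPE(('ox, 'mx) cat_data) A B (prod_cat A B) (proj0 A B) (proj1 A B)"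
  unfolding lens_product_cone_def
proof (intro conjI allI impI)
  show "lens (prod_cat A B) A (proj0 A B)" "lens (prod_cat A B) B (proj1 A B)"
    using assms by (simp_all add: lens_proj0 lens_proj1)
next
  fix X :: "('ox, 'mx) cat_data" and F G
  assume FG: "lens X A F \<and> lens X B G"
  interpret F: lens X A F using FG by simp
  interpret G: lens X B G using FG by simp
  interpret lens_span X A B F G by unfold_locales
  interpret commuting_lens_span X A B F G
    using assms by (intro commuting_if_discrete)
  show "\<exists>!H. lens X (prod_cat A B) H \<and> lens_comp X A (proj0 A B) H = F
      \<and> lens_comp X B (proj1 A B) H = G"
  proof (rule ex1I[of _ pair])
    fix H
    assume "lens X (prod_cat A B) H \<and> lens_comp X A (proj0 A B) H = F
      \<and> lens_comp X B (proj1 A B) H = G"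
    then show "H = pair"
      using assms lens_pair proj0_pair proj1_pair by (auto intro: proj_jointly_monic)
  qed (simp add: lens_pair proj0_pair proj1_pair)
qed

end
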